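(* Let $\mathbb{H}^+=\{z\in\mathbb{C}\mid \mathrm{Im}\,z>0\}$ and let $F\in\mathrm{Hol}(\mathbb{H}^+,\mathbb{H}^+)$ be the map $F(z)=z-1$, for which the sequence of iterates $\{F^n\}$ is compactly divergent. There exists a sequence $\{f_n\}_{n\ge1}$ in $\mathrm{Hol}(\mathbb{H}^+,\mathbb{H}^+)$ with $f_n\to F$ such that the left iterated function system $L_n=f_n\circ f_{n-1}\circ\dots\circ f_1$ neither converges in $\mathrm{Hol}(\mathbb{H}^+,\mathbb{H}^+)$ nor is compactly divergent.
   Context: $\mathrm{Hol}(X,X)$ is the space of holomorphic self-maps of a hyperbolic Riemann surface $X$ with the compact-open topology, so convergence is uniform convergence on compact subsets of $X$ with limit a self-map of $X$. A sequence $\{h_n\}$ in $\mathrm{Hol}(X,X)$ is compactly divergent if for any compact subset $K$ of $X$ there is a positive integer $n_0$ with $h_n(K)\cap K=\varnothing$ for all $n\ge n_0$. *)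

theory Defs
  imports "HOL-Analysis.Analysis"
begin

definition upper_half_plane :: "complex set" where
  "upper_half_plane = {z. Im z > 0}"

(* The surfaces considered are open subsets X of the complex plane. Self-maps of X are total
   functions whose values outside X are irrelevant: nothing below depends on them. *)

definition Hol :: "complex set \<Rightarrow> (complex \<Rightarrow> complex) set" where
  "Hol X = {f. f holomorphic_on X \<and> f ` X \<subseteq> X}"

(* The limit must itself be a self-map of X; a locally uniform limit with values on the boundary
   of X does not count. *)

definition converges_to_in_Hol ::
    "complex set \<Rightarrow> (nat \<Rightarrow> complex \<Rightarrow> complex) \<Rightarrow> (complex \<Rightarrow> complex) \<Rightarrow> bool" where
  "converges_to_in_Hol X h g \<longleftrightarrow>
     g \<in> Hol X \<and> (\<forall>K. compact K \<and> K \<subseteq> X \<longrightarrow> uniform_limit K h g sequentially)"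

definition convergent_in_Hol ::
    "complex set \<Rightarrow> (nat \<Rightarrow> complex \<Rightarrow> complex) \<Rightarrow> bool" where
  "convergent_in_Hol X h \<longleftrightarrow> (\<exists>g. converges_to_in_Hol X h g)"

definition compactly_divergent ::
    "complex set \<Rightarrow> (nat \<Rightarrow> complex \<Rightarrow> complex) \<Rightarrow> bool" where
  "compactly_divergent X h \<longleftrightarrow>
     (\<forall>K. compact K \<and> K \<subseteq> X \<longrightarrow> (\<exists>n0>0. \<forall>n\<ge>n0. h n ` K \<inter> K = {}))"

(* For n \<ge> 1 this is f n \<circ> ... \<circ> f 1. The value f 0 is never used. *)

primrec left_ifs :: "(nat \<Rightarrow> complex \<Rightarrow> complex) \<Rightarrow> nat \<Rightarrow> complex \<Rightarrow> complex" where
  "left_ifs f 0 = id"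
| "left_ifs f (Suc n) = f (Suc n) \<circ> left_ifs f n"

end

theory Submission
  imports Defs "HOL-Library.Discrete_Functions"
begin

text \<open>
  The translation \<open>F z = z - 1\<close> is a limit of elliptic automorphisms of finite order. A
  hyperbolic rotation by the small angle \<open>2 * pi / N\<close> about the far away point
  \<open>\<i> / sin (pi / N)\<close> moves points near the origin almost like \<open>F\<close>: the further away the centre,
  the more the rotation circles through these points look like horocycles based at infinity
  (lemma \<open>uniform_limit_elliptic_translation\<close>). Yet its \<open>N\<close>-th iterate is the identity
  (lemma \<open>elliptic_funpow_id\<close>).

  So let the maps \<open>f n\<close> run through such rotations of orders 2, 4, 8, ..., each one repeated as
  many times as its order. Then \<open>f n\<close> converges to \<open>F\<close>, but the left iterated function system is
  back at the identity at the end of every block, which excludes compact divergence. One step later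
  it equals the next rotation, which is close to \<open>F\<close>; hence a limit would send \<open>\<i>\<close> both to \<open>\<i>\<close> and
  to \<open>\<i> - 1\<close>, which excludes convergence.
\<close>

section \<open>Elliptic automorphisms of the upper half-plane\<close>

text \<open>
  The hyperbolic rotation by the angle \<open>2 * a\<close> about \<open>t * \<i>\<close>: the action of the rotation matrix
  with rows \<open>(cos a, - sin a)\<close> and \<open>(sin a, cos a)\<close>, conjugated by the dilation with factor \<open>t\<close>.
\<close>

definition elliptic :: "real \<Rightarrow> real \<Rightarrow> complex \<Rightarrow> complex" where
  "elliptic t a z =
     (of_real (cos a) * z - of_real (t * sin a)) / (of_real (sin a / t) * z + of_real (cos a))"

lemma elliptic_denominator_nonzero:
  assumes "t \<noteq> 0" "z \<in> upper_half_plane"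
  shows "of_real (sin a / t) * z + of_real (cos a) \<noteq> (0::complex)"
proof
  assume eq: "of_real (sin a / t) * z + of_real (cos a) = (0::complex)"
  have "sin a / t * Im z = 0"
    using arg_cong[OF eq, of Im] by simp
  then have "sin a = 0"
    using assms by (simp add: upper_half_plane_def)
  moreover have "cos a = 0"
    using arg_cong[OF eq, of Re] \<open>sin a = 0\<close> by simp
  ultimately show False
    using sin_cos_squared_add[of a] by simp
qed

lemma elliptic_in_Hol:
  assumes "t \<noteq> 0"
  shows "elliptic t a \<in> Hol upper_half_plane"
  unfolding Hol_def
proof (intro CollectI conjI image_subsetI)
  show "elliptic t a holomorphic_on upper_half_plane"
    unfolding elliptic_def
    by (intro holomorphic_intros elliptic_denominator_nonzero assms)
next
  fix z assume z: "z \<in> upper_half_plane"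
  let ?d = "of_real (sin a / t) * z + of_real (cos a)"
  have d: "?d \<noteq> 0"
    by (rule elliptic_denominator_nonzero[OF assms z])
  \<comment> \<open>The matrix has determinant \<open>(cos a)\<^sup>2 + (sin a)\<^sup>2 = 1\<close>.\<close>
  have "Im ((of_real (cos a) * z - of_real (t * sin a)) * cnj ?d)
      = ((cos a)\<^sup>2 + (sin a)\<^sup>2) * Im z"
    using assms
    by (simp add: field_simps power2_eq_square
        del: sin_cos_squared_add sin_cos_squared_add2 sin_cos_squared_add3)
  then have "Im (elliptic t a z) = Im z / (cmod ?d)\<^sup>2"
    unfolding elliptic_def complex_div_cnj[of _ ?d]
    by (simp only: Im_divide_of_real sin_cos_squared_add2 mult_1 flip: of_real_power)
  then show "elliptic t a z \<in> upper_half_plane"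
    using d z by (simp add: upper_half_plane_def)
qed

lemma elliptic_elliptic:
  assumes t: "t \<noteq> 0" and z: "z \<in> upper_half_plane"
  shows "elliptic t a (elliptic t b z) = elliptic t (a + b) z"
proof -
  have w: "elliptic t b z \<in> upper_half_plane"
    using elliptic_in_Hol[OF t] z by (auto simp: Hol_def)
  define p where "p = of_real (cos b) * z - of_real (t * sin b)"
  define d where "d = of_real (sin b / t) * z + of_real (cos b)"
  have d: "d \<noteq> 0"
    unfolding d_def by (rule elliptic_denominator_nonzero[OF t z])
  have eb: "elliptic t b z = p / d"
    by (simp add: elliptic_def p_def d_def)
  have "elliptic t a (elliptic t b z)
      = (of_real (cos a) * p - of_real (t * sin a) * d) / (of_real (sin a / t) * p + of_real (cos a) * d)"
  proof -
    have "of_real (cos a) * (p / d) - of_real (t * sin a)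
        = (of_real (cos a) * p - of_real (t * sin a) * d) / d"
      "of_real (sin a / t) * (p / d) + of_real (cos a)
        = (of_real (sin a / t) * p + of_real (cos a) * d) / d"
      using d by (simp_all add: diff_divide_distrib add_divide_distrib)
    moreover have "(x / d) / (y / d) = x / y" for x y
      using d by simp
    ultimately show ?thesis
      unfolding eb elliptic_def[of t a] by (simp only:)
  qed
  also have "of_real (cos a) * p - of_real (t * sin a) * d
      = of_real (cos (a + b)) * z - of_real (t * sin (a + b))"
    using t by (simp add: p_def d_def cos_add sin_add field_simps)
  also have "of_real (sin a / t) * p + of_real (cos a) * d
      = of_real (sin (a + b) / t) * z + of_real (cos (a + b))"
    using t by (simp add: p_def d_def cos_add sin_add field_simps)
  finally show ?thesis
    by (simp add: elliptic_def)
qed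

lemma elliptic_funpow:
  assumes "t \<noteq> 0" "z \<in> upper_half_plane"
  shows "(elliptic t a ^^ n) z = elliptic t (real n * a) z"
proof (induction n)
  case 0
  show ?case by (simp add: elliptic_def)
next
  case (Suc n)
  then show ?case
    using assms by (simp add: elliptic_elliptic algebra_simps)
qed

text \<open>The matrix of the iterate is a rotation matrix of angle \<open>pi\<close>, that is minus the identity.\<close>

lemma elliptic_funpow_id:
  assumes "t \<noteq> 0" "z \<in> upper_half_plane" "N > 0"
  shows "(elliptic t (pi / real N) ^^ N) z = z"
  using assms by (simp add: elliptic_funpow) (simp add: elliptic_def)

text \<open>
  The centre is tied to the angle so that the constant term \<open>t * sin a\<close> of the numerator is 1,
  while \<open>sin a / t = (sin a)\<^sup>2\<close> tends to 0.
\<close>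

lemma uniform_limit_elliptic_translation:
  assumes "bounded K"
  shows "uniform_limit K (\<lambda>a. elliptic (1 / sin a) a) (\<lambda>z. z - 1) (at 0)"
proof -
  obtain M where M: "M > 0" "\<And>z. z \<in> K \<Longrightarrow> norm z \<le> M"
    using assms by (auto simp: bounded_pos)
  define \<epsilon> where "\<epsilon> a = 2 * (\<bar>cos a - 1\<bar> + (sin a)\<^sup>2 * (M * (M + 1)))" for a
  have lim: "(\<epsilon> \<longlongrightarrow> 0) (at 0)"
    unfolding \<epsilon>_def by (rule tendsto_eq_intros refl | simp)+
  have "((\<lambda>a. cos a - (sin a)\<^sup>2 * M) \<longlongrightarrow> 1) (at 0)"
    by (rule tendsto_eq_intros refl | simp)+
  then have ev_den: "\<forall>\<^sub>F a in at 0. cos a - (sin a)\<^sup>2 * M > 1/2"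
    by (rule order_tendstoD) simp
  have ev_sin: "\<forall>\<^sub>F a in at 0. sin a \<noteq> (0::real)"
    unfolding eventually_at
  proof (intro exI[of _ pi] conjI ballI impI)
    fix a :: real assume a: "a \<noteq> 0 \<and> dist a 0 < pi"
    then show "sin a \<noteq> 0"
      using sin_eq_0_pi[of a] by (auto simp: dist_real_def abs_less_iff)
  qed simp
  have bound: "dist (elliptic (1 / sin a) a z) (z - 1) \<le> \<epsilon> a"
    if den: "cos a - (sin a)\<^sup>2 * M > 1/2" and s: "sin a \<noteq> 0" and z: "z \<in> K" for a z
  proof -
    define d where "d = of_real ((sin a)\<^sup>2) * z + of_real (cos a)"
    have "cos a = norm (d - of_real ((sin a)\<^sup>2) * z)" if "cos a \<ge> 0"
      using that by (simp add: d_def)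
    moreover have sz: "norm (of_real ((sin a)\<^sup>2) * z) \<le> (sin a)\<^sup>2 * M"
      using M(2)[OF z] by (simp add: norm_mult norm_power mult_left_mono)
    moreover have "(sin a)\<^sup>2 * M \<ge> 0"
      using M by simp
    ultimately have d: "norm d \<ge> 1/2"
      using den norm_triangle_ineq4[of d "of_real ((sin a)\<^sup>2) * z"] by linarith
    then have "d \<noteq> 0" by auto
    have "elliptic (1 / sin a) a z = (of_real (cos a) * z - 1) / d"
      using s by (simp add: elliptic_def d_def power2_eq_square)
    also have "\<dots> - (z - 1) = (of_real (cos a - 1) - of_real ((sin a)\<^sup>2) * (z * (z - 1))) / d"
      using \<open>d \<noteq> 0\<close> by (simp add: field_simps) (simp add: d_def algebra_simps)
    finally have "dist (elliptic (1 / sin a) a z) (z - 1)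
        = norm (of_real (cos a - 1) - of_real ((sin a)\<^sup>2) * (z * (z - 1))) / norm d"
      by (simp add: dist_norm norm_divide)
    also have "\<dots> \<le> (\<bar>cos a - 1\<bar> + (sin a)\<^sup>2 * (M * (M + 1))) / (1/2)"
    proof (rule frac_le)
      have "norm (z - 1) \<le> M + 1"
        using norm_triangle_ineq4[of z 1] M(2)[OF z] by simp
      then have "norm (of_real ((sin a)\<^sup>2) * (z * (z - 1))) \<le> (sin a)\<^sup>2 * (M * (M + 1))"
        unfolding norm_mult using M(1) M(2)[OF z]
        by (intro mult_mono) (auto simp: norm_power)
      moreover have "norm (of_real (cos a - 1) :: complex) = \<bar>cos a - 1\<bar>"
        by (rule norm_of_real)
      ultimately show "norm (of_real (cos a - 1) - of_real ((sin a)\<^sup>2) * (z * (z - 1)))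
          \<le> \<bar>cos a - 1\<bar> + (sin a)\<^sup>2 * (M * (M + 1))"
        using norm_triangle_ineq4[of "of_real (cos a - 1)" "of_real ((sin a)\<^sup>2) * (z * (z - 1))"]
        by linarith
    qed (use d M in auto)
    finally show ?thesis
      by (simp add: \<epsilon>_def)
  qed
  show ?thesis
    unfolding uniform_limit_iff
  proof (intro allI impI)
    fix e :: real assume "e > 0"
    with lim have "\<forall>\<^sub>F a in at 0. \<epsilon> a < e"
      by (rule order_tendstoD)
    with ev_den ev_sin
    show "\<forall>\<^sub>F a in at 0. \<forall>z\<in>K. dist (elliptic (1 / sin a) a z) (z - 1) < e"
      by eventually_elim (use bound le_less_trans in blast)
  qed
qed

section \<open>Left iterated function systems made of blocks of rotations\<close>

lemma left_ifs_constant_block: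
  assumes "\<And>i. m < i \<Longrightarrow> i \<le> m + j \<Longrightarrow> f i = g"
  shows "left_ifs f (m + j) = (g ^^ j) \<circ> left_ifs f m"
  using assms
proof (induction j)
  case (Suc j)
  have "left_ifs f (m + j) = (g ^^ j) \<circ> left_ifs f m"
    by (rule Suc.IH) (simp add: Suc.prems)
  moreover have "f (Suc (m + j)) = g" using Suc.prems by simp
  ultimately show ?case by (simp add: comp_assoc)
qed simp

text \<open>
  The \<open>k\<close>-th block, of length \<open>2 ^ k\<close>, consists of the \<open>n\<close> with \<open>2 ^ k \<le> n + 1 < 2 ^ (k + 1)\<close>.
  The shift by one makes \<open>k = 1\<close> the first block, because \<open>k = 0\<close> would give the angle \<open>pi\<close>, for
  which no suitable centre exists.
\<close>

definition block_angle :: "nat \<Rightarrow> real" where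
  "block_angle n = pi / real (2 ^ floor_log (Suc n))"

definition block_rotation :: "nat \<Rightarrow> complex \<Rightarrow> complex" where
  "block_rotation n = elliptic (1 / sin (block_angle n)) (block_angle n)"

lemma sin_block_angle_pos:
  assumes "n \<ge> 1"
  shows "sin (block_angle n) > 0"
proof (rule sin_gt_zero)
  have "floor_log (Suc n) \<ge> floor_log 2"
    using assms by (intro floor_log_le_iff) simp
  then have "(2::nat) ^ 1 \<le> 2 ^ floor_log (Suc n)"
    by (intro power_increasing) (simp_all add: floor_log_twice[of 1, simplified])
  then have "real 2 \<le> real (2 ^ floor_log (Suc n))"
    by (intro of_nat_mono) simp
  then show "block_angle n < pi"
    unfolding block_angle_def by (simp add: field_simps del: of_nat_power)
qed (simp add: block_angle_def)

lemma block_angle_tendsto_0: "filterlim block_angle (at 0) sequentially"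
  unfolding filterlim_at
proof
  show "\<forall>\<^sub>F n in sequentially. block_angle n \<in> UNIV \<and> block_angle n \<noteq> 0"
    by (simp add: block_angle_def)
  have "block_angle n \<le> 2 * pi / real (Suc n)" for n
  proof -
    have "Suc n \<le> 2 * 2 ^ floor_log (Suc n)"
      using floor_log_exp2_gt[of "Suc n"] by simp
    then have "real (Suc n) \<le> real (2 * 2 ^ floor_log (Suc n))"
      by (rule of_nat_mono)
    then have "2 * pi / real (2 * 2 ^ floor_log (Suc n)) \<le> 2 * pi / real (Suc n)"
      by (intro divide_left_mono) simp_all
    then show ?thesis by (simp add: block_angle_def)
  qed
  moreover have "(\<lambda>n. 2 * pi / real (Suc n)) \<longlonglongrightarrow> 0"
    by (rule LIMSEQ_Suc[OF lim_const_over_n])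
  ultimately show "block_angle \<longlonglongrightarrow> 0"
    by (intro tendsto_sandwich[of "\<lambda>_. 0" block_angle sequentially "\<lambda>n. 2 * pi / real (Suc n)"])
      (auto simp: block_angle_def)
qed

lemma block_rotation_uniform_limit:
  assumes "bounded K"
  shows "uniform_limit K block_rotation (\<lambda>z. z - 1) sequentially"
  using filterlim_compose[OF uniform_limit_elliptic_translation[OF assms] block_angle_tendsto_0]
  by (simp add: block_rotation_def[abs_def])

text \<open>Each block is a full turn, so after the blocks 1, ..., \<open>k\<close> every point is back at its place.\<close>

lemma left_ifs_block_rotation_return:
  assumes z: "z \<in> upper_half_plane"
  shows "left_ifs block_rotation (2 ^ Suc k - 2) z = z"
proof (induction k)
  case 0
  show ?case by simp
next
  case (Suc k)
  define m where "m = 2 ^ Suc k - (2::nat)"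
  have "(2::nat) \<le> 2 ^ Suc k"
    by simp
  then have m: "m + 2 = 2 ^ Suc k"
    unfolding m_def by linarith
  define a where "a = pi / real (2 ^ Suc k)"
  have angle: "block_angle i = a" if "m < i" "i \<le> m + 2 ^ Suc k" for i
  proof -
    have "floor_log (Suc i) = Suc k"
      by (rule floor_log_eqI) (use that m in auto)
    then show ?thesis by (simp add: block_angle_def a_def)
  qed
  have "sin a \<noteq> 0"
    using sin_block_angle_pos[of "Suc m"] angle[of "Suc m"] by simp
  have "left_ifs block_rotation (m + 2 ^ Suc k)
      = (elliptic (1 / sin a) a ^^ 2 ^ Suc k) \<circ> left_ifs block_rotation m"
    by (rule left_ifs_constant_block) (simp only: block_rotation_def angle)
  moreover have "left_ifs block_rotation m z = z"
    using Suc.IH by (simp only: m_def)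
  moreover have "(elliptic (1 / sin a) a ^^ 2 ^ Suc k) z = z"
    unfolding a_def
    by (rule elliptic_funpow_id) (use \<open>sin a \<noteq> 0\<close> z in \<open>simp_all add: a_def\<close>)
  moreover have "2 ^ Suc (Suc k) - 2 = m + 2 ^ Suc k"
    using m by simp
  ultimately show ?case
    by (simp only: comp_apply)
qed

section \<open>Iterates of the translation\<close>

lemma translation_funpow: "((\<lambda>z::complex. z - 1) ^^ n) z = z - of_nat n"
  by (induction n) simp_all

lemma compactly_divergent_translation_funpow:
  "compactly_divergent X (\<lambda>n. (\<lambda>z. z - 1) ^^ n)"
  unfolding compactly_divergent_def
proof (intro allI impI)
  fix K assume "compact K \<and> K \<subseteq> X"
  then have "bounded K"
    using compact_imp_bounded by blast
  then obtain B where B: "\<And>z. z \<in> K \<Longrightarrow> norm z \<le> B"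
    by (auto simp: bounded_iff)
  obtain n0 :: nat where n0: "2 * B < real n0"
    using reals_Archimedean2 by blast
  have "((\<lambda>z. z - 1) ^^ n) ` K \<inter> K = {}" if n: "n \<ge> Suc n0" for n
  proof (rule ccontr)
    assume "((\<lambda>z. z - 1) ^^ n) ` K \<inter> K \<noteq> {}"
    then obtain z where z: "z \<in> K" "z - of_nat n \<in> K"
      by (auto simp: translation_funpow)
    have "real n = norm (z - (z - of_nat n))"
      by simp
    also have "\<dots> \<le> norm z + norm (z - of_nat n)"
      by (rule norm_triangle_ineq4)
    also have "\<dots> \<le> 2 * B"
      using B[OF z(1)] B[OF z(2)] by simp
    finally show False
      using n n0 by simp
  qed
  then show "\<exists>n0>0. \<forall>n\<ge>n0. ((\<lambda>z. z - 1) ^^ n) ` K \<inter> K = {}"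
    by blast
qed

section \<open>A perturbation with recurrent orbits\<close>

theorem mainTheorem11:
  fixes F :: "complex \<Rightarrow> complex"
  defines "F \<equiv> (\<lambda>z. z - 1)"
  shows "F \<in> Hol upper_half_plane \<and>
    compactly_divergent upper_half_plane (\<lambda>n. F ^^ n) \<and>
    (\<exists>f :: nat \<Rightarrow> complex \<Rightarrow> complex.
       (\<forall>n\<ge>1. f n \<in> Hol upper_half_plane) \<and>
       converges_to_in_Hol upper_half_plane f F \<and>
       \<not> convergent_in_Hol upper_half_plane (left_ifs f) \<and>
       \<not> compactly_divergent upper_half_plane (left_ifs f))"
proof (intro conjI exI[of _ block_rotation])
  let ?L = "left_ifs block_rotation"
  let ?r = "\<lambda>k. 2 ^ Suc k - (2::nat)"
  have i: "\<i> \<in> upper_half_plane"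
    by (simp add: upper_half_plane_def)
  have return: "?L (?r k) \<i> = \<i>" for k
    by (rule left_ifs_block_rotation_return[OF i])
  have r: "filterlim ?r at_top sequentially"
  proof (rule filterlim_at_top_mono[OF filterlim_ident])
    have "k \<le> ?r k" for k
      using less_exp[of k] by (simp only: power_Suc)
    then show "\<forall>\<^sub>F k in sequentially. k \<le> ?r k" by simp
  qed
  show F: "F \<in> Hol upper_half_plane"
    unfolding F_def Hol_def by (auto simp: upper_half_plane_def intro!: holomorphic_intros)
  show "compactly_divergent upper_half_plane (\<lambda>n. F ^^ n)"
    unfolding F_def by (rule compactly_divergent_translation_funpow)
  show "\<forall>n\<ge>1. block_rotation n \<in> Hol upper_half_plane"
    unfolding block_rotation_def using sin_block_angle_pos
    by (intro allI impI elliptic_in_Hol) (metis divide_eq_0_iff less_irrefl zero_neq_one)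
  show "converges_to_in_Hol upper_half_plane block_rotation F"
    unfolding converges_to_in_Hol_def
    using F block_rotation_uniform_limit compact_imp_bounded by (auto simp: F_def)
  show "\<not> convergent_in_Hol upper_half_plane ?L"
  proof
    assume "convergent_in_Hol upper_half_plane ?L"
    then obtain g
      where "\<And>K. compact K \<Longrightarrow> K \<subseteq> upper_half_plane \<Longrightarrow> uniform_limit K ?L g sequentially"
      unfolding convergent_in_Hol_def converges_to_in_Hol_def by blast
    from this[of "{\<i>}"] i have "uniform_limit {\<i>} ?L g sequentially"
      by simp
    then have g: "(\<lambda>n. ?L n \<i>) \<longlonglongrightarrow> g \<i>"
      by (rule tendsto_uniform_limitI) simp
    have "(\<lambda>k. ?L (?r k) \<i>) \<longlonglongrightarrow> g \<i>"
      by (rule filterlim_compose[OF g r])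
    then have "g \<i> = \<i>"
      by (simp only: return LIMSEQ_const_iff)
    have r': "filterlim (\<lambda>k. Suc (?r k)) at_top sequentially"
      by (rule filterlim_compose[OF filterlim_Suc r])
    have "(\<lambda>k. ?L (Suc (?r k)) \<i>) \<longlonglongrightarrow> g \<i>"
      by (rule filterlim_compose[OF g r'])
    then have "(\<lambda>k. block_rotation (Suc (?r k)) \<i>) \<longlonglongrightarrow> g \<i>"
      by (simp only: left_ifs.simps comp_apply return)
    moreover have "(\<lambda>n. block_rotation n \<i>) \<longlonglongrightarrow> \<i> - 1"
      by (rule tendsto_uniform_limitI[OF block_rotation_uniform_limit[of "{\<i>}"]]) simp_all
    then have "(\<lambda>k. block_rotation (Suc (?r k)) \<i>) \<longlonglongrightarrow> \<i> - 1"
      by (rule filterlim_compose[OF _ r'])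
    ultimately have "g \<i> = \<i> - 1"
      by (rule LIMSEQ_unique)
    with \<open>g \<i> = \<i>\<close> show False by simp
  qed
  show "\<not> compactly_divergent upper_half_plane ?L"
  proof
    assume "compactly_divergent upper_half_plane ?L"
    then obtain n0 where n0: "\<And>n. n \<ge> n0 \<Longrightarrow> ?L n ` {\<i>} \<inter> {\<i>} = {}"
      using i unfolding compactly_divergent_def
      by (metis compact_insert compact_empty empty_subsetI insert_subset)
    obtain k where "?r k \<ge> n0"
      using r by (auto simp: filterlim_at_top eventually_sequentially)
    then show False
      using n0[of "?r k"] return[of k] by simp
  qed
qed

end
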